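(* Let $A\in\mathbb{R}^{m\times n}$ be full column rank with block structure given by $$A=\begin{bmatrix}\bar A_1\\ \bar A_2\\ \vdots\\ \bar A_\ell\end{bmatrix},\qquad \bar A_j\in\mathbb{R}^{m_j\times n},\quad \operatorname{rank}(\bar A_j)=m_j\ \text{ for all } j .$$ Then the $\omega$-optimal left-sided block diagonal preconditioner $$E:=\operatorname{Blkdiag}(E_1,E_2,\dots,E_\ell),\qquad E_j\in\mathbb{R}^{m_j\times m_j},$$ that minimizes the measure $\omega$, i.e. solves $$\min\ \omega\big((EA)^TEA\big),$$ is characterized by $$\bar A_j\bar A_j^T=\frac1n\left(\operatorname{trace}\sum_{t=1}^\ell\left(\bar A_t^T(E_t^TE_t)\bar A_t\right)\right)\bar A_j\left(A^T(E^TE)A\right)^{-1}\bar A_j^T,\qquad \forall j=1,\dots,\ell .$$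
   Context: For a symmetric positive definite $n\times n$ matrix $S$, $\omega(S)=\dfrac{\operatorname{trace}(S)/n}{\det(S)^{1/n}}$, the ratio of the arithmetic to the geometric mean of its eigenvalues. $\operatorname{Blkdiag}(E_1,\dots,E_\ell)$ is the block diagonal matrix with diagonal blocks $E_1,\dots,E_\ell$.
   Formalization: The preconditioner E being characterized is required to be nonsingular (each block E_j invertible); without this, a singular minimizer may violate the displayed equations. *)

theory Defs
  imports
    "Jordan_Normal_Form.DL_Rank"
    "Jordan_Normal_Form.Gauss_Jordan_Elimination"
begin

definition mat_trace :: "real mat \<Rightarrow> real" where
  "mat_trace M = (\<Sum>i<dim_row M. M $$ (i, i))"

definition pos_def :: "real mat \<Rightarrow> bool" where
  "pos_def M \<longleftrightarrow> square_mat M \<and> M\<^sup>T = M \<and>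
     (\<forall>v \<in> carrier_vec (dim_row M). v \<noteq> 0\<^sub>v (dim_row M) \<longrightarrow> v \<bullet> (M *\<^sub>v v) > 0)"

text \<open>Only meaningful for positive definite matrices of positive dimension.\<close>

definition omega :: "real mat \<Rightarrow> real" where
  "omega S = (mat_trace S / real (dim_row S)) / root (dim_row S) (det S)"

definition mat_rank :: "real mat \<Rightarrow> nat" where
  "mat_rank M = vec_space.rank (dim_row M) M"

text \<open>Unspecified if \<open>M\<close> is not invertible.\<close>

definition mat_inv :: "real mat \<Rightarrow> real mat" where
  "mat_inv M = the (mat_inverse M)"

text \<open>The explicit number \<open>n\<close> of columns is needed for the empty list: matrices of
  variable dimension have no common zero, hence also no \<open>sum_list\<close>.\<close>

definition stack_rows :: "nat \<Rightarrow> real mat list \<Rightarrow> real mat" where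
  "stack_rows n As = foldr (@\<^sub>r) As (0\<^sub>m 0 n)"

definition mat_sum_list :: "nat \<Rightarrow> real mat list \<Rightarrow> real mat" where
  "mat_sum_list n Ms = foldr (+) Ms (0\<^sub>m n n)"

definition square_blocks :: "nat list \<Rightarrow> real mat list set" where
  "square_blocks ms = {Es. length Es = length ms \<and>
     (\<forall>j<length ms. Es ! j \<in> carrier_mat (ms ! j) (ms ! j))}"

text \<open>The objective \<open>\<omega>((EA)\<^sup>T EA)\<close> with \<open>E = Blkdiag(E\<^sub>1, \<dots>, E\<^sub>\<ell>)\<close>, as a function of the
  list of blocks.\<close>

definition precond_gram :: "real mat \<Rightarrow> real mat list \<Rightarrow> real mat" where
  "precond_gram A Es = (diag_block_mat Es * A)\<^sup>T * (diag_block_mat Es * A)"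

definition precond_omega :: "real mat \<Rightarrow> real mat list \<Rightarrow> real" where
  "precond_omega A Es = omega (precond_gram A Es)"

text \<open>Two feasible sets for the minimization: the nonsingular block diagonal preconditioners,
  and all block diagonal matrices for which the objective is defined, that is, for which
  \<open>(EA)\<^sup>T EA\<close> is positive definite. If \<open>A\<close> has full column rank, the first is contained in the
  second; the second may contain singular \<open>E\<close> when \<open>A\<close> has more rows than columns.\<close>

definition nonsingular_blocks :: "nat list \<Rightarrow> real mat list set" where
  "nonsingular_blocks ms = {Es \<in> square_blocks ms. \<forall>E \<in> set Es. invertible_mat E}"

definition admissible_blocks :: "nat list \<Rightarrow> real mat \<Rightarrow> real mat list set" where
  "admissible_blocks ms A = {Es \<in> square_blocks ms. pos_def (precond_gram A Es)}"

end

theory Submission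
  imports
    Defs
    "Jordan_Normal_Form.Char_Poly"
    "Jordan_Normal_Form.Schur_Decomposition"
begin

text \<open>Write \<open>M = (EA)\<^sup>T EA\<close> and \<open>K = M\<^sup>-\<^sup>1\<close>. The map \<open>E \<mapsto> (EA)\<^sup>T EA\<close> is linear in the
  blocks \<open>E\<^sub>j\<^sup>T E\<^sub>j\<close>.

  The condition suffices: it gives \<open>trace N = (trace M / n) trace (K N)\<close> for every other
  admissible \<open>N = (FA)\<^sup>T FA\<close>, and \<open>trace (K N) / n \<ge> (det N / det M)\<^sup>1\<^sup>/\<^sup>n\<close> is AM-GM for the
  eigenvalues of \<open>K N\<close>, which are real and positive.

  The condition is necessary: replacing \<open>E\<^sub>j\<close> by \<open>(1 + c u u\<^sup>T) E\<^sub>j\<close> changes \<open>M\<close> by a multiple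
  of \<open>w w\<^sup>T\<close>, where \<open>w = A\<^sub>j\<^sup>T v\<close> and \<open>v = E\<^sub>j\<^sup>T u\<close>. The matrix determinant lemma makes \<open>\<omega>\<close>
  explicit along this curve, and its vanishing derivative at \<open>c = 0\<close> says that the quadratic
  forms of the two sides of the condition agree at \<open>v\<close>, which is arbitrary since \<open>E\<^sub>j\<close> is
  nonsingular.\<close>

section \<open>Pairs of positive definite matrices\<close>

text \<open>AM-GM: divide by the mean \<open>m\<close> and apply x \<le> exp (x - 1) to each factor;
  the exponents then sum to zero.\<close>

lemma mean_power_ge_prod:
  fixes e :: "nat \<Rightarrow> real"
  assumes n: "n \<ge> 1" and e: "\<And>i. i < n \<Longrightarrow> e i > 0"
  shows "(\<Prod>i<n. e i) \<le> ((\<Sum>i<n. e i) / real n) ^ n"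
proof -
  define m where "m = (\<Sum>i<n. e i) / real n"
  have "(\<Sum>i<n. e i) > 0" using n e by (intro sum_pos) (auto simp: lessThan_empty_iff)
  then have m: "m > 0" using n by (simp add: m_def)
  have "(\<Prod>i<n. e i / m) \<le> (\<Prod>i<n. exp (e i / m - 1))"
    using e m exp_ge_add_one_self[of "e _ / m - 1"]
    by (intro prod_mono) (auto intro: less_imp_le)
  also have "\<dots> = exp (\<Sum>i<n. e i / m - 1)" by (simp add: exp_sum)
  also have "(\<Sum>i<n. e i / m - 1) = 0"
    using n m by (simp add: sum_subtractf flip: sum_divide_distrib) (simp add: m_def field_simps)
  finally have "(\<Prod>i<n. e i) / m ^ n \<le> 1" by (simp add: prod_dividef)
  then show ?thesis using m by (simp add: m_def[symmetric])
qed

text \<open>Cyclicity of the trace, kept over a general semiring because the complex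
  triangularization below needs it as well as the real \<open>mat_trace\<close>.\<close>

lemma sum_diag_mult_commute:
  fixes A B :: "'a :: comm_semiring_0 mat"
  assumes "A \<in> carrier_mat n m" "B \<in> carrier_mat m n"
  shows "(\<Sum>i<n. (A * B) $$ (i, i)) = (\<Sum>i<m. (B * A) $$ (i, i))"
proof -
  have "(\<Sum>i<n. (A * B) $$ (i, i)) = (\<Sum>i<n. \<Sum>k<m. A $$ (i, k) * B $$ (k, i))"
    using assms by (auto simp: scalar_prod_def atLeast0LessThan intro!: sum.cong)
  also have "\<dots> = (\<Sum>k<m. \<Sum>i<n. B $$ (k, i) * A $$ (i, k))"
    by (subst sum.swap) (simp add: mult.commute)
  also have "\<dots> = (\<Sum>i<m. (B * A) $$ (i, i))"
    using assms by (auto simp: scalar_prod_def atLeast0LessThan intro!: sum.cong)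
  finally show ?thesis .
qed

lemma mat_trace_commute:
  assumes "A \<in> carrier_mat n m" "B \<in> carrier_mat m n"
  shows "mat_trace (A * B) = mat_trace (B * A)"
  using sum_diag_mult_commute[OF assms] assms by (simp add: mat_trace_def)

lemma mat_trace_add:
  assumes "A \<in> carrier_mat n n" "B \<in> carrier_mat n n"
  shows "mat_trace (A + B) = mat_trace A + mat_trace B"
  using assms by (simp add: mat_trace_def sum.distrib)

lemma mat_trace_smult:
  assumes "A \<in> carrier_mat n n"
  shows "mat_trace (c \<cdot>\<^sub>m A) = c * mat_trace A"
  using assms by (simp add: mat_trace_def sum_distrib_left)

lemma symmetric_scalar_prod_commute:
  fixes M :: "real mat"
  assumes "M \<in> carrier_mat n n" "M\<^sup>T = M" "x \<in> carrier_vec n" "y \<in> carrier_vec n"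
  shows "x \<bullet> (M *\<^sub>v y) = y \<bullet> (M *\<^sub>v x)"
proof -
  have "x \<bullet> (M *\<^sub>v y) = (M\<^sup>T *\<^sub>v x) \<bullet> y"
    using transpose_vec_mult_scalar[OF assms(1) assms(4) assms(3)] by simp
  then show ?thesis using assms by (simp add: comm_scalar_prod[of _ n])
qed

lemma pos_defD:
  assumes "pos_def M" "M \<in> carrier_mat n n"
  shows "M\<^sup>T = M" "\<And>v. v \<in> carrier_vec n \<Longrightarrow> v \<noteq> 0\<^sub>v n \<Longrightarrow> v \<bullet> (M *\<^sub>v v) > 0"
    "\<And>v. v \<in> carrier_vec n \<Longrightarrow> v \<bullet> (M *\<^sub>v v) \<ge> 0"
proof -
  show s: "M\<^sup>T = M" and p: "\<And>v. v \<in> carrier_vec n \<Longrightarrow> v \<noteq> 0\<^sub>v n \<Longrightarrow> v \<bullet> (M *\<^sub>v v) > 0"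
    using assms by (auto simp: pos_def_def)
  show "v \<bullet> (M *\<^sub>v v) \<ge> 0" if "v \<in> carrier_vec n" for v
    using that p[of v] assms by (cases "v = 0\<^sub>v n") (auto simp: less_imp_le)
qed

text \<open>Split \<open>N v = l M v\<close> with \<open>v = x + i y\<close> into real and imaginary parts. By symmetry of
  \<open>N\<close>, comparing \<open>y \<bullet> N x\<close> with \<open>x \<bullet> N y\<close> yields
  \<open>Im l (x \<bullet> M x + y \<bullet> M y) = 0\<close>.\<close>

lemma pos_def_pencil_eigenvalue:
  fixes M N C :: "real mat" and v :: "complex vec"
  assumes M: "pos_def M" "M \<in> carrier_mat n n" and N: "pos_def N" "N \<in> carrier_mat n n"
    and C: "C \<in> carrier_mat n n" "M * C = N"
    and v: "v \<in> carrier_vec n" "v \<noteq> 0\<^sub>v n"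
    and ev: "map_mat of_real C *\<^sub>v v = l \<cdot>\<^sub>v v"
  shows "Im l = 0 \<and> Re l > 0"
proof -
  define x y where "x = map_vec Re v" and "y = map_vec Im v"
  have xy: "x \<in> carrier_vec n" "y \<in> carrier_vec n" using v by (auto simp: x_def y_def)
  have cv: "(\<Sum>j<n. of_real (C $$ (i, j)) * v $ j) = l * v $ i" if "i < n" for i
    using arg_cong[OF ev, of "\<lambda>w. w $ i"] that v(1) C(1)
    by (simp add: scalar_prod_def atLeast0LessThan)
  have "C *\<^sub>v x = Re l \<cdot>\<^sub>v x + (- Im l) \<cdot>\<^sub>v y"
  proof (rule eq_vecI)
    fix i assume "i < dim_vec (Re l \<cdot>\<^sub>v x + - Im l \<cdot>\<^sub>v y)"
    then have i: "i < n" using xy by simp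
    show "(C *\<^sub>v x) $ i = (Re l \<cdot>\<^sub>v x + - Im l \<cdot>\<^sub>v y) $ i"
      using arg_cong[OF cv[OF i], of Re] i v(1) C(1)
      by (simp add: scalar_prod_def atLeast0LessThan x_def y_def)
  qed (use C xy in auto)
  moreover have "M *\<^sub>v (C *\<^sub>v x) = N *\<^sub>v x" using M C xy by (simp flip: C(2))
  ultimately have Nx: "N *\<^sub>v x = Re l \<cdot>\<^sub>v (M *\<^sub>v x) + (- Im l) \<cdot>\<^sub>v (M *\<^sub>v y)"
    using M(2) xy by (simp add: mult_add_distrib_mat_vec[of _ n n] mult_mat_vec[of _ n n])
  have "C *\<^sub>v y = Im l \<cdot>\<^sub>v x + Re l \<cdot>\<^sub>v y"
  proof (rule eq_vecI)
    fix i assume "i < dim_vec (Im l \<cdot>\<^sub>v x + Re l \<cdot>\<^sub>v y)"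
    then have i: "i < n" using xy by simp
    show "(C *\<^sub>v y) $ i = (Im l \<cdot>\<^sub>v x + Re l \<cdot>\<^sub>v y) $ i"
      using arg_cong[OF cv[OF i], of Im] i v(1) C(1)
      by (simp add: scalar_prod_def atLeast0LessThan x_def y_def)
  qed (use C xy in auto)
  moreover have "M *\<^sub>v (C *\<^sub>v y) = N *\<^sub>v y" using M C xy by (simp flip: C(2))
  ultimately have Ny: "N *\<^sub>v y = Im l \<cdot>\<^sub>v (M *\<^sub>v x) + Re l \<cdot>\<^sub>v (M *\<^sub>v y)"
    using M(2) xy by (simp add: mult_add_distrib_mat_vec[of _ n n] mult_mat_vec[of _ n n])
  have Mxy: "M *\<^sub>v x \<in> carrier_vec n" "M *\<^sub>v y \<in> carrier_vec n" using M(2) xy by auto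
  note pM = pos_defD[OF M] and pN = pos_defD[OF N]
  have nz: "x \<noteq> 0\<^sub>v n \<or> y \<noteq> 0\<^sub>v n"
  proof (rule ccontr)
    assume "\<not> ?thesis"
    then have "x $ i = 0 \<and> y $ i = 0" if "i < n" for i using that by simp
    then have "Re (v $ i) = 0" "Im (v $ i) = 0" if "i < n" for i
      using v(1) that by (auto simp: x_def y_def)
    then have "v = 0\<^sub>v n" using v(1) by (intro eq_vecI) (auto simp: complex_eq_iff)
    then show False using v(2) by simp
  qed
  \<comment> \<open>One of \<open>x\<close> and \<open>y\<close> contributes a strictly positive
    term, the other at least zero.\<close>
  have pos: "x \<bullet> (M *\<^sub>v x) + y \<bullet> (M *\<^sub>v y) > 0" "x \<bullet> (N *\<^sub>v x) + y \<bullet> (N *\<^sub>v y) > 0"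
    using nz pM(2)[OF xy(1)] pM(2)[OF xy(2)] pM(3)[OF xy(1)] pM(3)[OF xy(2)]
      pN(2)[OF xy(1)] pN(2)[OF xy(2)] pN(3)[OF xy(1)] pN(3)[OF xy(2)] by linarith+
  have e: "x \<bullet> (N *\<^sub>v x) = Re l * (x \<bullet> (M *\<^sub>v x)) - Im l * (x \<bullet> (M *\<^sub>v y))"
    "y \<bullet> (N *\<^sub>v x) = Re l * (y \<bullet> (M *\<^sub>v x)) - Im l * (y \<bullet> (M *\<^sub>v y))"
    "x \<bullet> (N *\<^sub>v y) = Im l * (x \<bullet> (M *\<^sub>v x)) + Re l * (x \<bullet> (M *\<^sub>v y))"
    "y \<bullet> (N *\<^sub>v y) = Im l * (y \<bullet> (M *\<^sub>v x)) + Re l * (y \<bullet> (M *\<^sub>v y))"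
    using xy Mxy by (simp_all add: Nx Ny scalar_prod_add_distrib[of _ n])
  have sM: "y \<bullet> (M *\<^sub>v x) = x \<bullet> (M *\<^sub>v y)" and sN: "y \<bullet> (N *\<^sub>v x) = x \<bullet> (N *\<^sub>v y)"
    using symmetric_scalar_prod_commute M N pM(1) pN(1) xy by blast+
  have "Im l * (x \<bullet> (M *\<^sub>v x) + y \<bullet> (M *\<^sub>v y)) = 0"
    using e sM sN by (simp add: algebra_simps)
  then have im: "Im l = 0" using pos by simp
  have "x \<bullet> (N *\<^sub>v x) + y \<bullet> (N *\<^sub>v y) = Re l * (x \<bullet> (M *\<^sub>v x) + y \<bullet> (M *\<^sub>v y))"
    using e im by (simp add: algebra_simps)
  then have "Re l > 0" using pos by (metis zero_less_mult_pos2)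
  with im show ?thesis by simp
qed

text \<open>The \<open>e i\<close> are the generalized eigenvalues of \<open>N\<close> relative to
  \<open>M\<close>. A complex Schur form of \<open>K * N\<close> carries them on its diagonal; the
  previous lemma makes them real and positive, and trace and determinant are invariant under
  similarity.\<close>

lemma pos_def_pencil_diag:
  fixes M N K :: "real mat"
  assumes M: "pos_def M" "M \<in> carrier_mat n n" and N: "pos_def N" "N \<in> carrier_mat n n"
    and K: "K \<in> carrier_mat n n" "M * K = 1\<^sub>m n"
  obtains e :: "nat \<Rightarrow> real" where "\<And>i. i < n \<Longrightarrow> e i > 0"
    "mat_trace (K * N) = (\<Sum>i<n. e i)" "det N = det M * (\<Prod>i<n. e i)"
proof -
  define C where "C = K * N"
  define C' where "C' = map_mat complex_of_real C"
  have C: "C \<in> carrier_mat n n" "M * C = N" and C': "C' \<in> carrier_mat n n"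
    using M(2) N(2) K by (auto simp: C_def C'_def assoc_mult_mat[symmetric, of _ n n _ n _ n])
  obtain as where as: "char_poly C' = (\<Prod>a\<leftarrow>as. [:- a, 1:])"
    using char_poly_factorized[OF C'] by blast
  obtain B where B: "B \<in> carrier_mat n n" "upper_triangular B" "similar_mat C' B"
    using schur_decomposition_exists[OF C' as] by blast
  obtain P Q where "similar_mat_wit C' B P Q" using B(3) by (auto simp: similar_mat_def)
  note PQ = similar_mat_witD2(6,7,2,3)[OF C' this]
  \<comment> \<open>A second factorization, now over the diagonal of \<open>B\<close>, which
    exhibits each diagonal entry as an eigenvalue of \<open>C'\<close>.\<close>
  have cp: "char_poly C' = (\<Prod>a\<leftarrow>diag_mat B. [:- a, 1:])"
    using char_poly_similar[OF B(3)] char_poly_upper_triangular[OF B(1,2)] by simp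
  have ev: "Im (B $$ (i, i)) = 0 \<and> Re (B $$ (i, i)) > 0" if i: "i < n" for i
  proof -
    have "B $$ (i, i) \<in> set (diag_mat B)" using i B(1) by (auto simp: diag_mat_def)
    then have "poly (char_poly C') (B $$ (i, i)) = 0"
      unfolding cp by (auto simp: poly_prod_list prod_list_zero_iff)
    then have "eigenvalue C' (B $$ (i, i))" using eigenvalue_root_char_poly[OF C'] by simp
    then obtain v where "v \<in> carrier_vec n" "v \<noteq> 0\<^sub>v n" "C' *\<^sub>v v = B $$ (i, i) \<cdot>\<^sub>v v"
      using C' by (auto simp: eigenvalue_def eigenvector_def)
    then show ?thesis using pos_def_pencil_eigenvalue[OF M N C] by (simp add: C'_def)
  qed
  define e where "e i = Re (B $$ (i, i))" for i
  have e: "B $$ (i, i) = complex_of_real (e i)" if "i < n" for i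
    using ev[OF that] by (simp add: e_def complex_eq_iff)
  have "complex_of_real (mat_trace C) = (\<Sum>i<n. C' $$ (i, i))"
    using C by (simp add: mat_trace_def C'_def)
  \<comment> \<open>With \<open>C' = P * B * Q\<close>, cyclicity moves \<open>Q\<close> next to its
    inverse \<open>P\<close>.\<close>
  also have "\<dots> = (\<Sum>i<n. (Q * (P * B)) $$ (i, i))"
    unfolding PQ(4) by (rule sum_diag_mult_commute) (use PQ B in auto)
  also have "Q * (P * B) = B" using assoc_mult_mat[OF PQ(2,1) B(1)] PQ(3) B(1) by simp
  finally have tr: "complex_of_real (mat_trace C) = complex_of_real (\<Sum>i<n. e i)" by (simp add: e)
  have "complex_of_real (det C) = det C'" by (simp add: C'_def of_real_hom.hom_det)
  also have "\<dots> = det B" using det_similar[OF B(3)] .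
  also have "\<dots> = (\<Prod>i<n. B $$ (i, i))"
    using det_upper_triangular[OF B(2,1)] B(1)
    by (simp add: diag_mat_def prod.list_conv_set_nth atLeast0LessThan)
  also have "\<dots> = complex_of_real (\<Prod>i<n. e i)" by (simp add: e)
  finally have dt: "complex_of_real (det C) = complex_of_real (\<Prod>i<n. e i)" .
  show ?thesis
  proof (rule that)
    show "\<And>i. i < n \<Longrightarrow> e i > 0" using ev by (simp add: e_def)
    show "mat_trace (K * N) = (\<Sum>i<n. e i)" using tr unfolding C_def of_real_eq_iff .
    have "det N = det M * det C" using det_mult[OF M(2) C(1)] C(2) by simp
    then show "det N = det M * (\<Prod>i<n. e i)" using dt unfolding of_real_eq_iff by simp
  qed
qed

section \<open>Determinant, trace and inverse of a positive definite matrix, and comparison of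
  \<open>omega\<close>\<close>

lemma pos_def_one: "pos_def (1\<^sub>m n)"
proof -
  have "v \<bullet> v > 0" if "v \<in> carrier_vec n" "v \<noteq> 0\<^sub>v n" for v :: "real vec"
    using conjugate_square_greater_0_vec[OF that(1)] that by simp
  then show ?thesis by (auto simp: pos_def_def)
qed

text \<open>Taken relative to the identity, the generalized eigenvalues are the ordinary eigenvalues
  of \<open>M\<close>.\<close>

lemma pos_def_det_trace:
  assumes "pos_def M" "M \<in> carrier_mat n n"
  shows "det M > 0" "n \<ge> 1 \<Longrightarrow> mat_trace M > 0"
proof -
  obtain e :: "nat \<Rightarrow> real" where e: "\<And>i. i < n \<Longrightarrow> e i > 0"
    "mat_trace (1\<^sub>m n * M) = (\<Sum>i<n. e i)" "det M = det (1\<^sub>m n) * (\<Prod>i<n. e i)"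
    using pos_def_pencil_diag[OF pos_def_one one_carrier_mat assms, where K = "1\<^sub>m n"] by auto
  show "det M > 0" using e(1,3) by (auto intro!: prod_pos)
  assume "n \<ge> 1"
  then show "mat_trace M > 0" using e(1,2) assms by (auto intro!: sum_pos simp: lessThan_empty_iff)
qed

text \<open>A nonzero determinant makes \<open>mat_inverse\<close> return a value, so
  \<open>mat_inv\<close> is a true inverse. It is symmetric because its transpose is a left inverse
  too, and a left and a right inverse coincide.\<close>

lemma pos_def_inverse:
  assumes M: "pos_def M" "M \<in> carrier_mat n n"
  shows "mat_inv M \<in> carrier_mat n n" "M * mat_inv M = 1\<^sub>m n" "mat_inv M * M = 1\<^sub>m n"
    "(mat_inv M)\<^sup>T = mat_inv M"
proof -
  have "det M \<noteq> 0" using pos_def_det_trace(1)[OF M] by simp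
  then have "M \<in> Units (ring_mat TYPE(real) n ())" by (rule det_non_zero_imp_unit[OF M(2)])
  then obtain K where "mat_inverse M = Some K"
    using mat_inverse(1)[OF M(2), where b = "()"] by (cases "mat_inverse M") auto
  then show K: "mat_inv M \<in> carrier_mat n n" "M * mat_inv M = 1\<^sub>m n" "mat_inv M * M = 1\<^sub>m n"
    using mat_inverse(2)[OF M(2)] by (auto simp: mat_inv_def)
  have "(mat_inv M)\<^sup>T * M = 1\<^sub>m n"
    using transpose_mult[OF M(2) K(1)] K(2) pos_defD(1)[OF M] by simp
  then have "(mat_inv M)\<^sup>T * M * mat_inv M = mat_inv M" using K by simp
  moreover have "(mat_inv M)\<^sup>T * M * mat_inv M = (mat_inv M)\<^sup>T"
    using K M(2) by (subst assoc_mult_mat[of _ n n _ n _ n]) auto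
  ultimately show "(mat_inv M)\<^sup>T = mat_inv M" by simp
qed

text \<open>AM-GM for the generalized eigenvalues bounds the root of \<open>det N\<close> by that of
  \<open>det M\<close> times \<open>mat_trace (mat_inv M * N) / n\<close>. After multiplication by
  the mean eigenvalue of \<open>M\<close>, the trace hypothesis removes the inverse and leaves the
  claim with denominators cleared.\<close>

lemma omega_le_if_trace_eq:
  assumes n: "n \<ge> 1" and M: "pos_def M" "M \<in> carrier_mat n n" and N: "pos_def N" "N \<in> carrier_mat n n"
    and tr: "mat_trace N = mat_trace M / real n * mat_trace (mat_inv M * N)"
  shows "omega M \<le> omega N"
proof -
  note K = pos_def_inverse[OF M]
  obtain e :: "nat \<Rightarrow> real" where e: "\<And>i. i < n \<Longrightarrow> e i > 0"
    "mat_trace (mat_inv M * N) = (\<Sum>i<n. e i)" "det N = det M * (\<Prod>i<n. e i)"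
    using pos_def_pencil_diag[OF M N K(1,2)] by blast
  have dM: "det M > 0" and tM: "mat_trace M > 0" and dN: "det N > 0"
    using pos_def_det_trace M N n by blast+
  have "root n (det N) = root n (det M) * root n (\<Prod>i<n. e i)" by (simp add: e(3) real_root_mult)
  also have "root n (\<Prod>i<n. e i) \<le> root n (((\<Sum>i<n. e i) / real n) ^ n)"
    using mean_power_ge_prod[OF n, of e] e(1) n by simp
  also have "\<dots> = (\<Sum>i<n. e i) / real n"
    using n e(1) by (intro real_root_power_cancel divide_nonneg_nonneg sum_nonneg) (auto intro: less_imp_le)
  finally have "root n (det N) \<le> root n (det M) * ((\<Sum>i<n. e i) / real n)"
    using dM n by (simp add: mult_left_mono)
  then have "mat_trace M / real n * root n (det N)
      \<le> mat_trace M / real n * (root n (det M) * ((\<Sum>i<n. e i) / real n))"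
    using tM n by (intro mult_left_mono) auto
  also have "\<dots> = mat_trace N / real n * root n (det M)"
    by (simp add: tr e(2))
  finally have "mat_trace M / real n * root n (det N) \<le> mat_trace N / real n * root n (det M)" .
  then show ?thesis
    using M N dM dN n by (simp add: omega_def field_simps)
qed

section \<open>Rank-one perturbations\<close>

definition outer_prod :: "real vec \<Rightarrow> real vec \<Rightarrow> real mat" where
  "outer_prod v w = mat (dim_vec v) (dim_vec w) (\<lambda>(i, j). v $ i * w $ j)"

lemma outer_prod_carrier [simp]:
  "v \<in> carrier_vec n \<Longrightarrow> w \<in> carrier_vec m \<Longrightarrow> outer_prod v w \<in> carrier_mat n m"
  by (simp add: outer_prod_def carrier_matI)

lemma transpose_outer_prod: "(outer_prod v w)\<^sup>T = outer_prod w v"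
  by (intro eq_matI) (auto simp: outer_prod_def)

lemma mult_outer_prod:
  assumes "A \<in> carrier_mat k n" "v \<in> carrier_vec n"
  shows "A * outer_prod v w = outer_prod (A *\<^sub>v v) w"
  using assms
  by (intro eq_matI) (auto simp: outer_prod_def scalar_prod_def sum_distrib_right mult.assoc)

lemma outer_prod_mult:
  assumes "B \<in> carrier_mat n k" "w \<in> carrier_vec n"
  shows "outer_prod v w * B = outer_prod v (B\<^sup>T *\<^sub>v w)"
  using assms
  by (intro eq_matI) (auto simp: outer_prod_def scalar_prod_def sum_distrib_left mult_ac)

lemma smult_outer_prod: "c \<cdot>\<^sub>m outer_prod v w = outer_prod (c \<cdot>\<^sub>v v) w"
  by (intro eq_matI) (auto simp: outer_prod_def)

lemma mat_trace_outer_prod: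
  "v \<in> carrier_vec n \<Longrightarrow> w \<in> carrier_vec n \<Longrightarrow> mat_trace (outer_prod v w) = v \<bullet> w"
  by (simp add: mat_trace_def outer_prod_def scalar_prod_def atLeast0LessThan)

text \<open>Both sides are the determinant of the block matrix \<open>Q\<close> with rows \<open>(1, X)\<close> and \<open>(-Y, 1)\<close>,
  computed by eliminating either off-diagonal block.\<close>

lemma det_one_plus_mult_commute:
  fixes X Y :: "'a :: idom mat"
  assumes X: "X \<in> carrier_mat n m" and Y: "Y \<in> carrier_mat m n"
  shows "det (1\<^sub>m n + X * Y) = det (1\<^sub>m m + Y * X)"
proof -
  define Q where "Q = four_block_mat (1\<^sub>m n) X (- Y) (1\<^sub>m m)"
  define P where "P = four_block_mat (1\<^sub>m n + X * Y) X (0\<^sub>m m n) (1\<^sub>m m)"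
  define R where "R = four_block_mat (1\<^sub>m n) (0\<^sub>m n m) (- Y) (1\<^sub>m m)"
  define S where "S = four_block_mat (1\<^sub>m n) (- X) (0\<^sub>m m n) (1\<^sub>m m)"
  define T where "T = four_block_mat (1\<^sub>m n) (0\<^sub>m n m) (- Y) (1\<^sub>m m + Y * X)"
  note defs = Q_def P_def R_def S_def T_def
  have [simp]: "Q \<in> carrier_mat (n + m) (n + m)" "P \<in> carrier_mat (n + m) (n + m)"
    "R \<in> carrier_mat (n + m) (n + m)" "S \<in> carrier_mat (n + m) (n + m)"
    using X Y by (auto simp: defs)
  have XY: "X * Y \<in> carrier_mat n n" "Y * X \<in> carrier_mat m m" using X Y by auto
  have "1\<^sub>m n + X * Y + X * - Y = 1\<^sub>m n" using X Y XY
    by (intro eq_matI) (auto simp: uminus_mult_right_mat)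
  then have PR: "P * R = Q" unfolding defs
    by (subst mult_four_block_mat[of _ n n _ m _ m]) (use X Y XY in auto)
  have "- Y * - X + 1\<^sub>m m = 1\<^sub>m m + Y * X" using X Y XY
    by (intro eq_matI) (auto simp: uminus_mult_right_mat uminus_mult_left_mat)
  moreover have "- X + X = 0\<^sub>m n m" using X by (intro eq_matI) auto
  ultimately have QS: "Q * S = T" unfolding defs
    by (subst mult_four_block_mat[of _ n n _ m _ m]) (use X Y XY in auto)
  have dP: "det P = det (1\<^sub>m n + X * Y)" unfolding P_def
    using X XY by (subst det_four_block_mat_lower_left_zero[of _ n _ m]) auto
  have dS: "det S = 1" unfolding S_def
    using X by (subst det_four_block_mat_lower_left_zero[of _ n _ m]) auto
  have dR: "det R = 1" unfolding R_def
    using Y by (subst det_four_block_mat_upper_right_zero[of _ n _ m]) auto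
  have dT: "det T = det (1\<^sub>m m + Y * X)" unfolding T_def
    using Y XY by (subst det_four_block_mat_upper_right_zero[of _ n _ m]) auto
  have "det P * det R = det Q" by (simp flip: PR add: det_mult[of _ "n + m"])
  moreover have "det Q * det S = det T" by (simp flip: QS add: det_mult[of _ "n + m"])
  ultimately show ?thesis by (simp add: dP dR dS dT)
qed

text \<open>The outer product is a column times a row; in the opposite order the product is a 1 x 1
  matrix.\<close>

lemma det_one_plus_outer_prod:
  assumes v: "v \<in> carrier_vec n" and w: "w \<in> carrier_vec n"
  shows "det (1\<^sub>m n + outer_prod v w) = 1 + w \<bullet> v"
proof -
  have "outer_prod v w = mat_of_cols n [v] * mat_of_rows n [w]"
    using assms by (intro eq_matI)
      (auto simp: outer_prod_def scalar_prod_def mat_of_cols_def mat_of_rows_def)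
  moreover have "mat_of_cols n [v] \<in> carrier_mat n 1" "mat_of_rows n [w] \<in> carrier_mat 1 n"
    by (auto intro: carrier_matI)
  ultimately have "det (1\<^sub>m n + outer_prod v w) = det (1\<^sub>m 1 + mat_of_rows n [w] * mat_of_cols n [v])"
    using det_one_plus_mult_commute by simp
  also have "\<dots> = 1 + w \<bullet> v"
    using assms by (subst det_single) (auto simp: carrier_matI)
  finally show ?thesis .
qed

text \<open>Matrix determinant lemma: factor out \<open>M\<close>, leaving the identity plus the
  outer product of \<open>s K w\<close> and \<open>w\<close>.\<close>

lemma det_rank_one_update:
  assumes M: "M \<in> carrier_mat n n" and K: "K \<in> carrier_mat n n" "M * K = 1\<^sub>m n"
    and w: "w \<in> carrier_vec n"
  shows "det (M + s \<cdot>\<^sub>m outer_prod w w) = det M * (1 + s * (w \<bullet> (K *\<^sub>v w)))"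
proof -
  have sKw: "s \<cdot>\<^sub>v (K *\<^sub>v w) \<in> carrier_vec n" using K w by simp
  have "M *\<^sub>v (s \<cdot>\<^sub>v (K *\<^sub>v w)) = s \<cdot>\<^sub>v (M *\<^sub>v (K *\<^sub>v w))"
    using M K w by (intro mult_mat_vec) auto
  also have "M *\<^sub>v (K *\<^sub>v w) = w"
    using M K w by (simp flip: assoc_mult_mat_vec[OF M K(1) w])
  finally have "M * outer_prod (s \<cdot>\<^sub>v (K *\<^sub>v w)) w = s \<cdot>\<^sub>m outer_prod w w"
    by (simp add: mult_outer_prod[OF M sKw] smult_outer_prod)
  then have "M + s \<cdot>\<^sub>m outer_prod w w = M * (1\<^sub>m n + outer_prod (s \<cdot>\<^sub>v (K *\<^sub>v w)) w)"
    using M sKw w by (subst mult_add_distrib_mat[of _ n n]) auto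
  then have "det (M + s \<cdot>\<^sub>m outer_prod w w) = det M * det (1\<^sub>m n + outer_prod (s \<cdot>\<^sub>v (K *\<^sub>v w)) w)"
    using M sKw w by (simp add: det_mult[of _ n])
  then show ?thesis
    using K w sKw by (simp add: det_one_plus_outer_prod)
qed

text \<open>The coefficient \<open>2 * c + c\<^sup>2 * r\<close> is the one that the factor 1 + c u
  u^T produces in a Gram matrix, with \<open>r = u \<bullet> u\<close>. Positive definiteness along
  the curve allows the inequality for \<open>omega\<close> to be cleared of roots and denominators,
  so that only a polynomial in \<open>c\<close> has to be differentiated.\<close>

lemma omega_rank_one_stationary:
  assumes n: "n \<ge> 1" and M: "pos_def M" "M \<in> carrier_mat n n" and w: "w \<in> carrier_vec n"
    and d: "d > 0"
    and min: "\<And>c. \<bar>c\<bar> < d \<Longrightarrow> pos_def (M + (2 * c + c\<^sup>2 * r) \<cdot>\<^sub>m outer_prod w w) \<and>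
      omega M \<le> omega (M + (2 * c + c\<^sup>2 * r) \<cdot>\<^sub>m outer_prod w w)"
  shows "w \<bullet> w = mat_trace M / real n * (w \<bullet> (mat_inv M *\<^sub>v w))"
proof -
  define t a b where "t = mat_trace M" and "a = w \<bullet> w" and "b = w \<bullet> (mat_inv M *\<^sub>v w)"
  define s where "s c = 2 * c + c\<^sup>2 * r" for c
  \<comment> \<open>Nonnegativity of \<open>h c\<close> is the inequality for \<open>omega\<close>,
    raised to the power \<open>n\<close> and freed of \<open>det M\<close>.\<close>
  define h where "h c = (t + s c * a) ^ n - t ^ n * (1 + s c * b)" for c
  note K = pos_def_inverse[OF M]
  have t: "t > 0" and D: "det M > 0" using pos_def_det_trace[OF M] n by (auto simp: t_def)
  have h_nonneg: "h c \<ge> 0" if c: "\<bar>c\<bar> < d" for c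
  proof -
    define N where "N = M + s c \<cdot>\<^sub>m outer_prod w w"
    have N: "pos_def N" "N \<in> carrier_mat n n" "omega M \<le> omega N"
      using min[OF c] M w by (auto simp: N_def s_def)
    have tN: "mat_trace N = t + s c * a" and dN: "det N = det M * (1 + s c * b)"
      using M w det_rank_one_update[OF M(2) K(1,2) w, of "s c"]
      by (simp_all add: N_def mat_trace_add[of _ n] mat_trace_smult[of _ n]
          mat_trace_outer_prod[of _ n] t_def a_def b_def)
    have tN_pos: "t + s c * a > 0" and dN_pos: "det N > 0"
      using pos_def_det_trace[OF N(1,2)] n tN by auto
    then have b_pos: "1 + s c * b > 0" using dN D by (simp add: zero_less_mult_iff)
    have "t / (real n * root n (det M)) \<le> (t + s c * a) / root n (1 + s c * b) / (real n * root n (det M))"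
      using N(2,3) M(2) by (simp add: omega_def tN dN t_def real_root_mult mult_ac)
    moreover have "real n * root n (det M) > 0" "root n (1 + s c * b) > 0"
      using n D b_pos by auto
    ultimately have le: "t * root n (1 + s c * b) \<le> t + s c * a"
      by (metis divide_le_cancel less_asym pos_le_divide_eq)
    have "t ^ n * (1 + s c * b) = (t * root n (1 + s c * b)) ^ n"
      using n b_pos by (simp add: power_mult_distrib)
    also have "\<dots> \<le> (t + s c * a) ^ n"
      using le t n b_pos by (intro power_mono) auto
    finally show ?thesis by (simp add: h_def)
  qed
  have "(h has_real_derivative (real n * t ^ (n - 1) * (2 * a) - t ^ n * (2 * b))) (at 0)"
    unfolding h_def[abs_def] s_def[abs_def] by (auto intro!: derivative_eq_intros)
  \<comment> \<open>Since \<open>h 0 = 0\<close>, nonnegativity near 0 is a local minimum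
    there.\<close>
  moreover have "\<forall>y. \<bar>0 - y\<bar> < d \<longrightarrow> h 0 \<le> h y"
    using h_nonneg by (simp add: h_def s_def)
  ultimately have "real n * t ^ (n - 1) * (2 * a) - t ^ n * (2 * b) = 0"
    using DERIV_local_min[of h _ 0 d] d by blast
  \<comment> \<open>Here \<open>n \<ge> 1\<close> matters: with truncated subtraction the equation
    can fail for \<open>n = 0\<close>.\<close>
  moreover have "t ^ n = t * t ^ (n - 1)" using n by (cases n) auto
  ultimately have "t ^ (n - 1) * (real n * a - t * b) = 0" by (simp add: algebra_simps)
  then have "real n * a = t * b" using t by simp
  then show ?thesis using n by (simp add: a_def b_def t_def field_simps)
qed

text \<open>The factor \<open>H\<close> is symmetric, so the Gram matrix is
  \<open>E\<^sup>T * (H * H) * E\<close>; as \<open>U * U\<close> is a multiple of \<open>U\<close>,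
  the change is exactly of rank at most one for every \<open>c\<close>, not just to first
  order.\<close>

lemma gram_rank_one_update:
  fixes c :: real
  assumes E: "E \<in> carrier_mat k k" and u: "u \<in> carrier_vec k"
  defines "F \<equiv> (1\<^sub>m k + c \<cdot>\<^sub>m outer_prod u u) * E"
  shows "F\<^sup>T * F = E\<^sup>T * E + (2 * c + c\<^sup>2 * (u \<bullet> u)) \<cdot>\<^sub>m outer_prod (E\<^sup>T *\<^sub>v u) (E\<^sup>T *\<^sub>v u)"
proof -
  define U where "U = outer_prod u u"
  define H where "H = 1\<^sub>m k + c \<cdot>\<^sub>m U"
  have U: "U \<in> carrier_mat k k" "U\<^sup>T = U" using u by (auto simp: U_def transpose_outer_prod)
  have "(c \<cdot>\<^sub>m U)\<^sup>T = c \<cdot>\<^sub>m U\<^sup>T" by (intro eq_matI) auto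
  then have H: "H \<in> carrier_mat k k" "H\<^sup>T = H"
    using U by (auto simp: H_def transpose_add[of _ k k])
  have "U *\<^sub>v u = (u \<bullet> u) \<cdot>\<^sub>v u"
    using u by (intro eq_vecI)
      (auto simp: U_def outer_prod_def scalar_prod_def sum_distrib_left mult_ac)
  then have UU: "U * U = (u \<bullet> u) \<cdot>\<^sub>m U"
    using mult_outer_prod[OF U(1) u, of u] by (simp add: U_def smult_outer_prod)
  have "H * H = H + (c \<cdot>\<^sub>m U) * H"
    using U H by (subst H_def, subst add_mult_distrib_mat[of _ k k]) auto
  also have "(c \<cdot>\<^sub>m U) * H = c \<cdot>\<^sub>m U + c \<cdot>\<^sub>m (c \<cdot>\<^sub>m (U * U))"
    using U by (simp add: H_def mult_add_distrib_mat[of _ k k _ k] mult_smult_assoc_mat[of _ k k _ k]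
        mult_smult_distrib[of _ k k _ k])
  also have "H + (c \<cdot>\<^sub>m U + c \<cdot>\<^sub>m (c \<cdot>\<^sub>m (U * U))) = 1\<^sub>m k + (2 * c + c\<^sup>2 * (u \<bullet> u)) \<cdot>\<^sub>m U"
    unfolding UU using U by (intro eq_matI) (auto simp: H_def algebra_simps power2_eq_square)
  finally have HH: "H * H = 1\<^sub>m k + (2 * c + c\<^sup>2 * (u \<bullet> u)) \<cdot>\<^sub>m U" .
  have "F\<^sup>T * F = E\<^sup>T * H * (H * E)"
    unfolding F_def U_def[symmetric] H_def[symmetric]
    using transpose_mult[OF H(1) E] H(2) by simp
  also have "\<dots> = E\<^sup>T * (H * H) * E"
    using E H by (simp add: assoc_mult_mat[of _ k k _ k _ k])
  also have "\<dots> = E\<^sup>T * E + (2 * c + c\<^sup>2 * (u \<bullet> u)) \<cdot>\<^sub>m (E\<^sup>T * U * E)"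
    unfolding HH using E U
    by (simp add: mult_add_distrib_mat[of _ k k _ k] add_mult_distrib_mat[of _ k k _ _ k]
        mult_smult_assoc_mat[of _ k k _ k] mult_smult_distrib[of _ k k _ k])
  also have "E\<^sup>T * U * E = outer_prod (E\<^sup>T *\<^sub>v u) (E\<^sup>T *\<^sub>v u)"
    using E u by (simp add: U_def mult_outer_prod[of _ k k] outer_prod_mult[of _ k k])
  finally show ?thesis .
qed

text \<open>Serves to keep the perturbed block nonsingular for small \<open>c\<close>.\<close>

lemma det_rank_one_factor:
  assumes "u \<in> carrier_vec k"
  shows "det (1\<^sub>m k + c \<cdot>\<^sub>m outer_prod u u) = 1 + c * (u \<bullet> u)"
  using assms by (simp add: smult_outer_prod det_one_plus_outer_prod)

section \<open>Equality by quadratic forms, invertibility, and full column rank\<close>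

text \<open>Polarization: the quadratic form at a sum of two unit vectors recovers the entry at
  their indices.\<close>

lemma symmetric_mat_eqI:
  fixes A B :: "real mat"
  assumes A: "A \<in> carrier_mat k k" "A\<^sup>T = A" and B: "B \<in> carrier_mat k k" "B\<^sup>T = B"
    and eq: "\<And>v. v \<in> carrier_vec k \<Longrightarrow> v \<bullet> (A *\<^sub>v v) = v \<bullet> (B *\<^sub>v v)"
  shows "A = B"
proof (rule eq_matI)
  fix i j assume "i < dim_row B" "j < dim_col B"
  then have ij: "i < k" "j < k" using B by auto
  define x y :: "real vec" where "x = unit_vec k i" and "y = unit_vec k j"
  have xy: "x \<in> carrier_vec k" "y \<in> carrier_vec k" by (auto simp: x_def y_def)
  have pol: "(x + y) \<bullet> (C *\<^sub>v (x + y)) = x \<bullet> (C *\<^sub>v x) + y \<bullet> (C *\<^sub>v y) + 2 * C $$ (i, j)"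
    if C: "C \<in> carrier_mat k k" "C\<^sup>T = C" for C
  proof -
    have Cxy: "C *\<^sub>v x \<in> carrier_vec k" "C *\<^sub>v y \<in> carrier_vec k" using C xy by auto
    have "y \<bullet> (C *\<^sub>v x) = x \<bullet> (C *\<^sub>v y)"
      using symmetric_scalar_prod_commute[OF C] xy by simp
    moreover have "x \<bullet> (C *\<^sub>v y) = C $$ (i, j)"
      using C ij by (simp add: x_def y_def)
    ultimately show ?thesis
      using xy Cxy C by (simp add: mult_add_distrib_mat_vec[of _ k k] scalar_prod_add_distrib[of _ k]
          add_scalar_prod_distrib[of _ k])
  qed
  show "A $$ (i, j) = B $$ (i, j)"
    using pol[OF A] pol[OF B] eq[of x] eq[of y] eq[of "x + y"] xy by simp
qed (use A B in auto)

lemma invertible_mat_iff_det: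
  fixes E :: "'a :: field mat"
  assumes E: "E \<in> carrier_mat k k"
  shows "invertible_mat E \<longleftrightarrow> det E \<noteq> 0"
proof
  assume "invertible_mat E"
  then obtain B where B: "E * B = 1\<^sub>m k" "B * E = 1\<^sub>m (dim_row B)"
    using E by (auto simp: invertible_mat_def inverts_mat_def)
  \<comment> \<open>\<open>invertible_mat\<close> does not fix the shape of the inverse; the column
    counts in the two equations determine it.\<close>
  have "B \<in> carrier_mat k k"
    using arg_cong[OF B(1), of dim_col] arg_cong[OF B(2), of dim_col] E by (auto intro: carrier_matI)
  then have "det E * det B = 1" using det_mult[OF E] B(1) by (metis det_one)
  then show "det E \<noteq> 0" by auto
next
  assume "det E \<noteq> 0"
  then have "E \<in> Units (ring_mat TYPE('a) k ())" by (rule det_non_zero_imp_unit[OF E])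
  then obtain B where "B \<in> carrier_mat k k" "B * E = 1\<^sub>m k" "E * B = 1\<^sub>m k"
    by (auto simp: Units_def ring_mat_def)
  then show "invertible_mat E" using E by (auto simp: invertible_mat_def inverts_mat_def)
qed

text \<open>A nonzero kernel vector is a linear dependence among the columns. Independence concerns
  the set of columns, so repetitions have to be excluded first: rank \<open>n\<close> requires
  \<open>n\<close> different columns.\<close>

lemma full_column_rank_kernel:
  assumes A: "A \<in> carrier_mat m n" and rank: "mat_rank A = n"
    and v: "v \<in> carrier_vec n" "A *\<^sub>v v = 0\<^sub>v m"
  shows "v = 0\<^sub>v n"
proof -
  interpret vec_space "TYPE(real)" m .
  have r: "rank A = n" using rank A by (simp add: mat_rank_def)
  have "distinct (cols A)"
  proof (rule card_distinct)
    obtain S where S: "maximal S (\<lambda>T. T \<subseteq> set (cols A) \<and> lin_indpt T)"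
      using maximal_exists[of "\<lambda>T. T \<subseteq> set (cols A) \<and> lin_indpt T" "card (set (cols A))" "{}"]
      by (meson List.finite_set card_mono empty_iff empty_subsetI finite_lin_indpt2 rev_finite_subset)
    then have "n \<le> card (set (cols A))"
      using rank_card_indpt[OF A S] r by (simp add: card_mono maximal_def)
    then show "card (set (cols A)) = length (cols A)"
      using A card_length[of "cols A"] by simp
  qed
  then show ?thesis
    using lin_depI[OF A v(1) _ v(2)] full_rank_lin_indpt[OF A r] by blast
qed

section \<open>Block structure\<close>

text \<open>List form of \<open>square_blocks\<close> that reads the block sizes off
  \<open>As\<close>, suited to induction with \<open>list_all2\<close>.\<close>

definition blocks_fit :: "nat \<Rightarrow> real mat list \<Rightarrow> real mat list \<Rightarrow> bool" where
  "blocks_fit n Es As \<longleftrightarrow> list_all2 (\<lambda>E A. A \<in> carrier_mat (dim_row A) n \<and>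
     E \<in> carrier_mat (dim_row A) (dim_row A)) Es As"

text \<open>Contribution of a single block to the Gram matrix, bracketed as in the summands of the
  theorem.\<close>

definition block_gram :: "real mat \<Rightarrow> real mat \<Rightarrow> real mat" where
  "block_gram E A = A\<^sup>T * (E\<^sup>T * E) * A"

text \<open>Stacking is a \<open>four_block_mat\<close> with an empty second block column, so the
  block product has a single nonempty block.\<close>

lemma append_rows_gram:
  fixes X Y :: "'a :: comm_semiring_0 mat"
  assumes X: "X \<in> carrier_mat k n" and Y: "Y \<in> carrier_mat m n"
  shows "(X @\<^sub>r Y)\<^sup>T * (X @\<^sub>r Y) = X\<^sup>T * X + Y\<^sup>T * Y"
proof -
  have "(X @\<^sub>r Y)\<^sup>T = four_block_mat X\<^sup>T Y\<^sup>T (0\<^sub>m 0 k) (0\<^sub>m 0 m)"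
    unfolding append_rows_def using X Y by (subst transpose_four_block_mat[of _ k n _ 0 _ m]) auto
  moreover have "X @\<^sub>r Y = four_block_mat X (0\<^sub>m k 0) Y (0\<^sub>m m 0)"
    using X Y by (simp add: append_rows_def)
  ultimately have "(X @\<^sub>r Y)\<^sup>T * (X @\<^sub>r Y) =
      four_block_mat (X\<^sup>T * X + Y\<^sup>T * Y) (0\<^sub>m n 0) (0\<^sub>m 0 n) (0\<^sub>m 0 0)"
    using X Y by (simp, subst mult_four_block_mat[of _ n k _ m _ 0]) auto
  also have "\<dots> = X\<^sup>T * X + Y\<^sup>T * Y" using X Y by (intro eq_matI) auto
  finally show ?thesis .
qed

lemma block_diag_mult_append_rows:
  fixes E D X Y :: "'a :: comm_semiring_0 mat"
  assumes "E \<in> carrier_mat k k" "D \<in> carrier_mat m m" "X \<in> carrier_mat k n" "Y \<in> carrier_mat m n"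
  shows "four_block_mat E (0\<^sub>m k m) (0\<^sub>m m k) D * (X @\<^sub>r Y) = (E * X) @\<^sub>r (D * Y)"
  unfolding append_rows_def using assms
  by (subst mult_four_block_mat[of _ k k _ m _ m]) auto

lemma mat_sum_list_carrier:
  "\<forall>M \<in> set Ms. M \<in> carrier_mat n n \<Longrightarrow> mat_sum_list n Ms \<in> carrier_mat n n"
  by (induction Ms) (auto simp: mat_sum_list_def)

lemma mat_trace_mult_mat_sum_list:
  assumes "\<forall>M \<in> set Ms. M \<in> carrier_mat n n" "K \<in> carrier_mat n n"
  shows "mat_trace (K * mat_sum_list n Ms) = (\<Sum>M\<leftarrow>Ms. mat_trace (K * M))"
  using assms
proof (induction Ms)
  case Nil
  then show ?case by (simp add: mat_sum_list_def mat_trace_def)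
next
  case (Cons M Ms)
  then have "mat_sum_list n Ms \<in> carrier_mat n n" by (intro mat_sum_list_carrier) auto
  then show ?case using Cons
    by (simp add: mat_sum_list_def mult_add_distrib_mat[of _ n n _ n] mat_trace_add[of _ n])
qed

lemma mat_sum_list_update:
  assumes "\<forall>M \<in> set Ms. M \<in> carrier_mat n n" "B \<in> carrier_mat n n" "j < length Ms"
  shows "mat_sum_list n (Ms[j := Ms ! j + B]) = mat_sum_list n Ms + B"
  using assms
proof (induction Ms arbitrary: j)
  case (Cons M Ms)
  then have c: "mat_sum_list n Ms \<in> carrier_mat n n" "M \<in> carrier_mat n n"
    by (auto intro: mat_sum_list_carrier)
  show ?case
  proof (cases j)
    case 0
    then show ?thesis using c Cons.prems by (auto simp: mat_sum_list_def intro!: eq_matI)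
  next
    case (Suc i)
    then have "mat_sum_list n (Ms[i := Ms ! i + B]) = mat_sum_list n Ms + B"
      using Cons by auto
    then show ?thesis using c Cons.prems Suc
      by (simp add: mat_sum_list_def assoc_add_mat[of _ n n])
  qed
qed simp

text \<open>A block diagonal matrix acts on a stack block by block, which splits the Gram matrix
  into a sum over the blocks. All four facts come from one induction because each step needs the
  shapes of the remaining matrices.\<close>

lemma blocks_fit_stack:
  assumes "blocks_fit n Es As"
  defines "m \<equiv> sum_list (map dim_row As)"
  shows "diag_block_mat Es \<in> carrier_mat m m" "stack_rows n As \<in> carrier_mat m n"
    "precond_gram (stack_rows n As) Es = mat_sum_list n (map2 block_gram Es As)"
    "(\<forall>E \<in> set Es. det E \<noteq> 0) \<Longrightarrow> det (diag_block_mat Es) \<noteq> 0"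
proof -
  have "diag_block_mat Es \<in> carrier_mat (sum_list (map dim_row As)) (sum_list (map dim_row As)) \<and>
    stack_rows n As \<in> carrier_mat (sum_list (map dim_row As)) n \<and>
    precond_gram (stack_rows n As) Es = mat_sum_list n (map2 block_gram Es As) \<and>
    ((\<forall>E \<in> set Es. det E \<noteq> 0) \<longrightarrow> det (diag_block_mat Es) \<noteq> 0)"
    using assms(1) unfolding blocks_fit_def
  proof (induction rule: list_all2_induct)
    case Nil
    \<comment> \<open>An empty inner dimension yields the \<open>n\<close> x \<open>n\<close> zero
      matrix, the start value of \<open>mat_sum_list\<close>.\<close>
    have "(0\<^sub>m 0 n)\<^sup>T * (0\<^sub>m 0 n) = (0\<^sub>m n n :: real mat)" by (intro eq_matI) (auto simp: scalar_prod_def)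
    then show ?case
      by (auto simp: precond_gram_def stack_rows_def mat_sum_list_def det_dim_zero)
  next
    case (Cons E Es A As)
    define k m D S where "k = dim_row A" and "m = sum_list (map dim_row As)"
      and "D = diag_block_mat Es" and "S = stack_rows n As"
    have A: "A \<in> carrier_mat k n" and E: "E \<in> carrier_mat k k"
      and D: "D \<in> carrier_mat m m" and S: "S \<in> carrier_mat m n"
      and IH: "(D * S)\<^sup>T * (D * S) = mat_sum_list n (map2 block_gram Es As)"
        "(\<forall>E \<in> set Es. det E \<noteq> 0) \<longrightarrow> det D \<noteq> 0"
      using Cons by (auto simp: k_def m_def D_def S_def precond_gram_def)
    have diag: "diag_block_mat (E # Es) = four_block_mat E (0\<^sub>m k m) (0\<^sub>m m k) D"
      using E D by (simp add: D_def[symmetric] Let_def)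
    have stack: "stack_rows n (A # As) = A @\<^sub>r S" by (simp add: S_def stack_rows_def)
    have "(E * A)\<^sup>T * (E * A) = block_gram E A"
      using A E by (simp add: block_gram_def transpose_mult[of _ k k] assoc_mult_mat[of _ n k _ k _ n]
        assoc_mult_mat[of _ k k _ k _ n])
    then have "precond_gram (stack_rows n (A # As)) (E # Es) =
        mat_sum_list n (map2 block_gram (E # Es) (A # As))"
      using A E D S IH(1) append_rows_gram[of "E * A" k n "D * S" m]
      unfolding precond_gram_def diag stack
      by (simp add: block_diag_mult_append_rows[of _ k _ m _ n] mat_sum_list_def)
    moreover have "det (diag_block_mat (E # Es)) = det E * det D"
      unfolding diag by (rule det_four_block_mat_upper_right_zero) (use E D in auto)
    moreover have "sum_list (map dim_row (A # As)) = k + m" by (simp add: k_def m_def)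
    moreover have "diag_block_mat (E # Es) \<in> carrier_mat (k + m) (k + m)"
      unfolding diag using E D by simp
    moreover have "stack_rows n (A # As) \<in> carrier_mat (k + m) n"
      unfolding stack using A S by simp
    ultimately show ?case using IH(2) by simp
  qed
  then show "diag_block_mat Es \<in> carrier_mat m m" "stack_rows n As \<in> carrier_mat m n"
    "precond_gram (stack_rows n As) Es = mat_sum_list n (map2 block_gram Es As)"
    "(\<forall>E \<in> set Es. det E \<noteq> 0) \<Longrightarrow> det (diag_block_mat Es) \<noteq> 0"
    by (auto simp: m_def)
qed

text \<open>The quadratic form at \<open>v\<close> is the squared length of
  \<open>B *\<^sub>v v\<close>.\<close>

lemma pos_def_gram:
  fixes B :: "real mat"
  assumes B: "B \<in> carrier_mat m n" and ker: "\<And>v. v \<in> carrier_vec n \<Longrightarrow> B *\<^sub>v v = 0\<^sub>v m \<Longrightarrow> v = 0\<^sub>v n"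
  shows "pos_def (B\<^sup>T * B)"
proof -
  have "v \<bullet> (B\<^sup>T * B *\<^sub>v v) > 0" if v: "v \<in> carrier_vec n" "v \<noteq> 0\<^sub>v n" for v
  proof -
    have Bv: "B *\<^sub>v v \<in> carrier_vec m" using B v by simp
    have "v \<bullet> (B\<^sup>T * B *\<^sub>v v) = v \<bullet> (B\<^sup>T *\<^sub>v (B *\<^sub>v v))"
      using B v by (simp add: assoc_mult_mat_vec[of _ n m])
    also have "\<dots> = (B *\<^sub>v v) \<bullet> (B *\<^sub>v v)"
      using transpose_vec_mult_scalar[OF B v(1) Bv] B Bv v
      by (simp add: comm_scalar_prod[of v n])
    also have "\<dots> > 0"
      using conjugate_square_greater_0_vec[OF Bv] ker v by auto
    finally show ?thesis .
  qed
  moreover have "(B\<^sup>T * B)\<^sup>T = B\<^sup>T * B" using B by (simp add: transpose_mult[of _ n m])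
  ultimately show ?thesis using B by (auto simp: pos_def_def)
qed

text \<open>A nonsingular block diagonal matrix after an injective stack is injective; full column
  rank enters here.\<close>

lemma pos_def_precond_gram:
  assumes fit: "blocks_fit n Es As" and inv: "\<forall>E \<in> set Es. det E \<noteq> 0"
    and rank: "mat_rank (stack_rows n As) = n"
  shows "pos_def (precond_gram (stack_rows n As) Es)"
proof -
  note D = blocks_fit_stack[OF fit]
  show ?thesis unfolding precond_gram_def
  proof (rule pos_def_gram)
    show "diag_block_mat Es * stack_rows n As \<in> carrier_mat (sum_list (map dim_row As)) n"
      using D(1,2) by simp
    fix v :: "real vec"
    assume v: "v \<in> carrier_vec n"
      and z: "diag_block_mat Es * stack_rows n As *\<^sub>v v = 0\<^sub>v (sum_list (map dim_row As))"
    have Sv: "stack_rows n As *\<^sub>v v \<in> carrier_vec (sum_list (map dim_row As))" using D(2) v by simp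
    have "diag_block_mat Es *\<^sub>v (stack_rows n As *\<^sub>v v) = 0\<^sub>v (sum_list (map dim_row As))"
      using z assoc_mult_mat_vec[OF D(1,2) v] by simp
    then have "stack_rows n As *\<^sub>v v = 0\<^sub>v (sum_list (map dim_row As))"
      using det_0_iff_vec_prod_zero[OF D(1)] D(4)[OF inv] Sv by blast
    then show "v = 0\<^sub>v n" using full_column_rank_kernel[OF D(2) rank v] by simp
  qed
qed

lemma block_gram_carrier:
  "A \<in> carrier_mat k n \<Longrightarrow> block_gram E A \<in> carrier_mat n n"
  by (auto simp: block_gram_def intro!: carrier_matI)

lemma block_gram_rank_one_update:
  assumes A: "A \<in> carrier_mat k n" and E: "E \<in> carrier_mat k k" and u: "u \<in> carrier_vec k"
  defines "w \<equiv> A\<^sup>T *\<^sub>v (E\<^sup>T *\<^sub>v u)"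
  shows "block_gram ((1\<^sub>m k + c \<cdot>\<^sub>m outer_prod u u) * E) A =
    block_gram E A + (2 * c + c\<^sup>2 * (u \<bullet> u)) \<cdot>\<^sub>m outer_prod w w"
proof -
  define O1 where "O1 = outer_prod (E\<^sup>T *\<^sub>v u) (E\<^sup>T *\<^sub>v u)"
  have O1: "O1 \<in> carrier_mat k k" "A\<^sup>T * O1 * A = outer_prod w w"
    using A E u by (simp_all add: O1_def w_def mult_outer_prod[of _ n k] outer_prod_mult[of _ k n])
  show ?thesis
    using A E O1 unfolding block_gram_def gram_rank_one_update[OF E u] O1_def[symmetric]
    by (simp add: mult_add_distrib_mat[of _ n k _ k] add_mult_distrib_mat[of _ n k _ _ n]
        mult_smult_assoc_mat[of _ n k _ n] mult_smult_distrib[of _ n k _ k])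
qed

text \<open>Only summand \<open>j\<close> of the Gram matrix moves, so a curve in one block becomes
  a multiple of a fixed outer product added to the whole.\<close>

lemma precond_gram_rank_one_update:
  fixes c :: real
  assumes fit: "blocks_fit n Es As" and j: "j < length Es" and k: "dim_row (As ! j) = k"
    and u: "u \<in> carrier_vec k"
  defines "w \<equiv> (As ! j)\<^sup>T *\<^sub>v ((Es ! j)\<^sup>T *\<^sub>v u)"
    and "Fs \<equiv> Es[j := (1\<^sub>m k + c \<cdot>\<^sub>m outer_prod u u) * Es ! j]"
  shows "blocks_fit n Fs As"
    "precond_gram (stack_rows n As) Fs =
      precond_gram (stack_rows n As) Es + (2 * c + c\<^sup>2 * (u \<bullet> u)) \<cdot>\<^sub>m outer_prod w w"
proof -
  define F where "F = (1\<^sub>m k + c \<cdot>\<^sub>m outer_prod u u) * Es ! j"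
  define W where "W = (2 * c + c\<^sup>2 * (u \<bullet> u)) \<cdot>\<^sub>m outer_prod w w"
  have len: "length Es = length As" using fit by (auto simp: blocks_fit_def dest: list_all2_lengthD)
  have AE: "As ! j \<in> carrier_mat k n" "Es ! j \<in> carrier_mat k k"
    using fit j k by (auto simp: blocks_fit_def list_all2_conv_all_nth)
  have F: "F \<in> carrier_mat k k" using AE u unfolding F_def
    by (intro mult_carrier_mat[of _ k k] add_carrier_mat smult_carrier_mat) auto
  have W: "W \<in> carrier_mat n n" using AE u by (simp add: W_def w_def)
  show fitF: "blocks_fit n Fs As"
    using fit j k F unfolding Fs_def F_def[symmetric] blocks_fit_def
    by (auto simp: list_all2_conv_all_nth nth_list_update)
  have "map2 block_gram Fs As = (map2 block_gram Es As)[j := (map2 block_gram Es As) ! j + W]"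
    using len j block_gram_rank_one_update[OF AE u, of c]
    unfolding Fs_def F_def[symmetric] W_def w_def
    by (intro nth_equalityI) (auto simp: nth_list_update)
  moreover have "\<forall>M \<in> set (map2 block_gram Es As). M \<in> carrier_mat n n"
    using fit by (auto simp: blocks_fit_def list_all2_conv_all_nth set_zip intro!: block_gram_carrier)
  ultimately show "precond_gram (stack_rows n As) Fs = precond_gram (stack_rows n As) Es + W"
    unfolding blocks_fit_stack(3)[OF fit] blocks_fit_stack(3)[OF fitF]
    using mat_sum_list_update[OF _ W, of "map2 block_gram Es As" j] j len by simp
qed

text \<open>Cyclicity isolates \<open>A * K * A\<^sup>T\<close>, the matrix that the optimality
  condition speaks about.\<close>

lemma mat_trace_block_gram:
  assumes A: "A \<in> carrier_mat k n" and E: "E \<in> carrier_mat k k" and K: "K \<in> carrier_mat n n"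
  shows "mat_trace (K * block_gram E A) = mat_trace (E\<^sup>T * E * (A * K * A\<^sup>T))"
proof -
  define X where "X = E\<^sup>T * E"
  have X: "X \<in> carrier_mat k k" using E by (simp add: X_def)
  have "K * (A\<^sup>T * X * A) = K * A\<^sup>T * X * A"
    using A X K by (simp add: assoc_mult_mat[of _ n n _ k _ n] assoc_mult_mat[of _ n k _ k _ n]
        assoc_mult_mat[of _ n n _ k _ k] assoc_mult_mat[of _ n n _ n _ k])
  then have "mat_trace (K * (A\<^sup>T * X * A)) = mat_trace (A * (K * A\<^sup>T * X))"
    using A X K by (simp add: mat_trace_commute[of A k n])
  also have "A * (K * A\<^sup>T * X) = A * K * A\<^sup>T * X"
    using A X K by (simp add: assoc_mult_mat[of _ k n _ n _ k] assoc_mult_mat[of _ k n _ k _ k]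
        assoc_mult_mat[of _ n n _ k _ k] assoc_mult_mat[of _ k k _ k _ k])
  also have "mat_trace \<dots> = mat_trace (X * (A * K * A\<^sup>T))"
    using A X K by (simp add: mat_trace_commute[of X k k])
  finally show ?thesis by (simp add: block_gram_def X_def)
qed

text \<open>Used with \<open>K\<close> the identity and with \<open>K\<close> the inverse Gram
  matrix, which produce the two sides of the condition.\<close>

lemma mat_trace_precond_gram:
  assumes fit: "blocks_fit n Es As" and K: "K \<in> carrier_mat n n"
  shows "mat_trace (K * precond_gram (stack_rows n As) Es) =
    (\<Sum>(E, A)\<leftarrow>zip Es As. mat_trace (E\<^sup>T * E * (A * K * A\<^sup>T)))"
proof -
  have z: "A \<in> carrier_mat (dim_row A) n \<and> E \<in> carrier_mat (dim_row A) (dim_row A)"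
    if "(E, A) \<in> set (zip Es As)" for E A
    using fit that by (auto simp: blocks_fit_def list_all2_iff)
  then have "\<forall>M \<in> set (map2 block_gram Es As). M \<in> carrier_mat n n"
    by (auto intro!: block_gram_carrier)
  then have "mat_trace (K * precond_gram (stack_rows n As) Es) =
      (\<Sum>p\<leftarrow>zip Es As. mat_trace (K * (case p of (E, A) \<Rightarrow> block_gram E A)))"
    unfolding blocks_fit_stack(3)[OF fit]
    by (simp add: mat_trace_mult_mat_sum_list[OF _ K] comp_def)
  also have "\<dots> = (\<Sum>(E, A)\<leftarrow>zip Es As. mat_trace (E\<^sup>T * E * (A * K * A\<^sup>T)))"
  proof (intro arg_cong[where f = sum_list] map_cong refl, clarify)
    fix E A assume "(E, A) \<in> set (zip Es As)"
    then show "mat_trace (K * block_gram E A) = mat_trace (E\<^sup>T * E * (A * K * A\<^sup>T))"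
      using z[of E A] mat_trace_block_gram[OF _ _ K] by blast
  qed
  finally show ?thesis .
qed

section \<open>Optimality and stationarity\<close>

text \<open>The condition of the theorem; the preconditioner enters it only through its Gram matrix
  \<open>M\<close>.\<close>

definition omega_stationary :: "nat \<Rightarrow> real mat \<Rightarrow> real mat list \<Rightarrow> bool" where
  "omega_stationary n M As \<longleftrightarrow> (\<forall>A \<in> set As.
     A * A\<^sup>T = (mat_trace M / real n) \<cdot>\<^sub>m (A * mat_inv M * A\<^sup>T))"

text \<open>Multiplying the condition for each block by \<open>F\<^sup>T * F\<close>, taking traces
  and summing gives the trace identity of \<open>omega_le_if_trace_eq\<close>. The competitor may be
  singular as long as its Gram matrix is positive definite.\<close>

lemma omega_le_if_stationary:
  assumes n: "n \<ge> 1"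
    and M: "pos_def M" "M \<in> carrier_mat n n" and st: "omega_stationary n M As"
    and fit: "blocks_fit n Fs As" and N: "pos_def (precond_gram (stack_rows n As) Fs)"
  shows "omega M \<le> precond_omega (stack_rows n As) Fs"
  unfolding precond_omega_def
proof (rule omega_le_if_trace_eq[OF n M N])
  let ?N = "precond_gram (stack_rows n As) Fs"
  note K = pos_def_inverse[OF M]
  show cN: "?N \<in> carrier_mat n n"
    using blocks_fit_stack(2)[OF fit] by (auto simp: precond_gram_def intro!: carrier_matI)
  \<comment> \<open>The identity is inserted so that both traces are expanded by the same
    formula.\<close>
  have "mat_trace ?N = mat_trace (1\<^sub>m n * ?N)" using cN by simp
  also have "\<dots> = (\<Sum>(F, A)\<leftarrow>zip Fs As. mat_trace (F\<^sup>T * F * (A * 1\<^sub>m n * A\<^sup>T)))"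
    by (rule mat_trace_precond_gram[OF fit]) simp
  also have "\<dots> = (\<Sum>(F, A)\<leftarrow>zip Fs As.
      mat_trace M / real n * mat_trace (F\<^sup>T * F * (A * mat_inv M * A\<^sup>T)))"
  proof (intro arg_cong[where f = sum_list] map_cong refl, clarify)
    fix F A assume p: "(F, A) \<in> set (zip Fs As)"
    define k where "k = dim_row A"
    have A: "A \<in> carrier_mat k n" and F: "F \<in> carrier_mat k k" and mem: "A \<in> set As"
      using fit p by (auto simp: blocks_fit_def list_all2_iff k_def dest: set_zip_rightD)
    have AKA: "A * mat_inv M * A\<^sup>T \<in> carrier_mat k k" and FF: "F\<^sup>T * F \<in> carrier_mat k k"
      using A F K(1) by (auto intro!: mult_carrier_mat)
    have "A * 1\<^sub>m n * A\<^sup>T = (mat_trace M / real n) \<cdot>\<^sub>m (A * mat_inv M * A\<^sup>T)"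
      using st mem A by (auto simp: omega_stationary_def)
    then show "mat_trace (F\<^sup>T * F * (A * 1\<^sub>m n * A\<^sup>T)) =
        mat_trace M / real n * mat_trace (F\<^sup>T * F * (A * mat_inv M * A\<^sup>T))"
      using mult_smult_distrib[OF FF AKA] mat_trace_smult[OF mult_carrier_mat[OF FF AKA]] by simp
  qed
  also have "\<dots> = mat_trace M / real n * mat_trace (mat_inv M * ?N)"
    unfolding mat_trace_precond_gram[OF fit K(1)]
    by (simp add: sum_list_const_mult[symmetric] split_def)
  finally show "mat_trace ?N = mat_trace M / real n * mat_trace (mat_inv M * ?N)" .
qed

text \<open>Minimality among nonsingular blocks is enough, since the rank-one curves stay
  nonsingular near their start.\<close>

lemma omega_stationary_if_minimal:
  fixes n :: nat and As Es :: "real mat list"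
  defines "A \<equiv> stack_rows n As"
  assumes n: "n \<ge> 1" and fit: "blocks_fit n Es As" and rank: "mat_rank A = n"
    and inv: "\<forall>E \<in> set Es. det E \<noteq> 0"
    and min: "\<And>Fs. blocks_fit n Fs As \<Longrightarrow> \<forall>F \<in> set Fs. det F \<noteq> 0 \<Longrightarrow>
      precond_omega A Es \<le> precond_omega A Fs"
  shows "omega_stationary n (precond_gram A Es) As"
  unfolding omega_stationary_def
proof
  fix B assume "B \<in> set As"
  then obtain j where j: "j < length Es" "As ! j = B"
    using fit by (auto simp: in_set_conv_nth blocks_fit_def dest: list_all2_lengthD)
  define k M E where "k = dim_row B" and "M = precond_gram A Es" and "E = Es ! j"
  have B: "B \<in> carrier_mat k n" and E: "E \<in> carrier_mat k k"
    using fit j by (auto simp: blocks_fit_def list_all2_conv_all_nth k_def E_def)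
  have dE: "det E \<noteq> 0" using inv j by (simp add: E_def)
  have M: "pos_def M" "M \<in> carrier_mat n n"
    using pos_def_precond_gram[OF fit inv] rank blocks_fit_stack(2)[OF fit]
    by (auto simp: M_def A_def precond_gram_def intro!: carrier_matI)
  note K = pos_def_inverse[OF M]
  define G where "G = B * mat_inv M * B\<^sup>T"
  have G: "G \<in> carrier_mat k k" using B K(1) by (auto simp: G_def intro!: mult_carrier_mat)
  have "G\<^sup>T = B * (B * mat_inv M)\<^sup>T"
    unfolding G_def using B K(1) by (subst transpose_mult[of _ k n _ k]) auto
  then have GT: "G\<^sup>T = G"
    using B K(1,4) by (simp add: G_def transpose_mult[OF B K(1)] assoc_mult_mat[of _ k n _ n _ k])
  define c where "c = mat_trace M / real n"
  have "B * B\<^sup>T = c \<cdot>\<^sub>m G"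
  proof (rule symmetric_mat_eqI[of _ k])
    show "B * B\<^sup>T \<in> carrier_mat k k" "c \<cdot>\<^sub>m G \<in> carrier_mat k k" using B G by auto
    show "(B * B\<^sup>T)\<^sup>T = B * B\<^sup>T" using B by (simp add: transpose_mult[of _ k n])
    have "(c \<cdot>\<^sub>m G)\<^sup>T = c \<cdot>\<^sub>m G\<^sup>T" by (intro eq_matI) auto
    then show "(c \<cdot>\<^sub>m G)\<^sup>T = c \<cdot>\<^sub>m G" by (simp add: GT)
  next
    fix v :: "real vec" assume v: "v \<in> carrier_vec k"
    have "det E\<^sup>T \<noteq> 0" using dE det_transpose[OF E] by simp
    then obtain L where L: "L \<in> carrier_mat k k" "E\<^sup>T * L = 1\<^sub>m k"
      using det_non_zero_imp_unit[of "E\<^sup>T" k] E by (auto simp: Units_def ring_mat_def)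
    \<comment> \<open>\<open>u\<close> solves \<open>E\<^sup>T *\<^sub>v u = v\<close>, so the
      perturbation can be aimed at any prescribed \<open>v\<close>.\<close>
    define u where "u = L *\<^sub>v v"
    have u: "u \<in> carrier_vec k" using L v by (simp add: u_def)
    have Eu: "E\<^sup>T *\<^sub>v u = v"
      using assoc_mult_mat_vec[of "E\<^sup>T" k k L k v] E L v by (simp add: u_def)
    define w where "w = B\<^sup>T *\<^sub>v v"
    have w: "w \<in> carrier_vec n" using B v by (simp add: w_def)
    \<comment> \<open>This bound makes \<open>c * (u \<bullet> u)\<close> smaller than 1 in absolute
      value; the summand 1 covers \<open>u = 0\<close>.\<close>
    define d where "d = 1 / (1 + u \<bullet> u)"
    have uu: "u \<bullet> u \<ge> 0" using conjugate_square_ge_0_vec[of u] by simp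
    have d: "d > 0" using uu by (simp add: d_def)
    have "w \<bullet> w = mat_trace M / real n * (w \<bullet> (mat_inv M *\<^sub>v w))"
    proof (rule omega_rank_one_stationary[OF n M w d])
      \<comment> \<open>This \<open>c\<close> is the curve parameter and hides the scalar
        \<open>c\<close> defined above.\<close>
      fix c :: real assume c: "\<bar>c\<bar> < d"
      define Fs where "Fs = Es[j := (1\<^sub>m k + c \<cdot>\<^sub>m outer_prod u u) * Es ! j]"
      have fitF: "blocks_fit n Fs As"
        and gram: "precond_gram A Fs = M + (2 * c + c\<^sup>2 * (u \<bullet> u)) \<cdot>\<^sub>m outer_prod w w"
        using precond_gram_rank_one_update[OF fit j(1) _ u, of c] j(2) Eu
        by (auto simp: Fs_def A_def M_def w_def k_def E_def)
      have "\<bar>c\<bar> * (u \<bullet> u) \<le> \<bar>c\<bar> * (1 + u \<bullet> u)" by (intro mult_left_mono) auto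
      also have "\<dots> < 1" using c uu by (simp add: d_def field_simps)
      finally have "\<bar>c * (u \<bullet> u)\<bar> < 1" using uu by (simp add: abs_mult)
      then have "1 + c * (u \<bullet> u) \<noteq> 0" by linarith
      then have "det ((1\<^sub>m k + c \<cdot>\<^sub>m outer_prod u u) * E) \<noteq> 0"
        using u E dE by (simp add: det_mult[of _ k] det_rank_one_factor)
      then have invF: "\<forall>F \<in> set Fs. det F \<noteq> 0"
        using inv set_update_subset_insert[of Es j] by (auto simp: Fs_def E_def)
      show "pos_def (M + (2 * c + c\<^sup>2 * (u \<bullet> u)) \<cdot>\<^sub>m outer_prod w w) \<and>
        omega M \<le> omega (M + (2 * c + c\<^sup>2 * (u \<bullet> u)) \<cdot>\<^sub>m outer_prod w w)"
        using pos_def_precond_gram[OF fitF invF] rank min[OF fitF invF] gram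
        by (simp add: A_def M_def precond_omega_def)
    qed
    \<comment> \<open>Both quadratic forms at \<open>v\<close> are rewritten through
      \<open>w\<close>, which turns the stationarity equation into their equality.\<close>
    moreover have "v \<bullet> (B * B\<^sup>T *\<^sub>v v) = w \<bullet> w"
    proof -
      have "B * B\<^sup>T *\<^sub>v v = B *\<^sub>v w"
        using assoc_mult_mat_vec[of B k n "B\<^sup>T" k v] B v by (simp add: w_def)
      then show ?thesis using transpose_vec_mult_scalar[OF B w v] by (simp add: w_def)
    qed
    moreover have "v \<bullet> (c \<cdot>\<^sub>m G *\<^sub>v v) = c * (w \<bullet> (mat_inv M *\<^sub>v w))"
    proof -
      have Kw: "mat_inv M *\<^sub>v w \<in> carrier_vec n" using K(1) w by simp
      have "G *\<^sub>v v = B * mat_inv M *\<^sub>v w"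
        unfolding G_def w_def using B K(1) v by (intro assoc_mult_mat_vec[of _ k n _ k]) auto
      also have "\<dots> = B *\<^sub>v (mat_inv M *\<^sub>v w)"
        using B K(1) w by (intro assoc_mult_mat_vec[of _ k n _ n]) auto
      finally have "v \<bullet> (G *\<^sub>v v) = w \<bullet> (mat_inv M *\<^sub>v w)"
        using transpose_vec_mult_scalar[OF B Kw v] by (simp add: w_def)
      moreover have "c \<cdot>\<^sub>m G *\<^sub>v v = c \<cdot>\<^sub>v (G *\<^sub>v v)"
        using G v by (intro eq_vecI) (auto simp: scalar_prod_def sum_distrib_left mult_ac)
      ultimately show ?thesis using v G by simp
    qed
    ultimately show "v \<bullet> (B * B\<^sup>T *\<^sub>v v) = v \<bullet> (c \<cdot>\<^sub>m G *\<^sub>v v)" by (simp add: c_def)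
  qed
  then show "B * B\<^sup>T = (mat_trace (precond_gram A Es) / real n) \<cdot>\<^sub>m (B * mat_inv (precond_gram A Es) * B\<^sup>T)"
    by (simp add: c_def G_def M_def)
qed

text \<open>Minimality over the smaller feasible set already forces the condition, and the condition
  yields minimality over the larger one, so one equation characterizes the minimizers for
  both.\<close>

theorem theorem3p12:
  fixes n :: nat and ms :: "nat list" and A :: "real mat" and As Es :: "real mat list"
  assumes n_pos: "n \<ge> 1"
    and len_As: "length As = length ms"
    and As_dim: "\<forall>j<length ms. As ! j \<in> carrier_mat (ms ! j) n"
    and As_rank: "\<forall>j<length ms. mat_rank (As ! j) = ms ! j"
    and A_blocks: "A = stack_rows n As"
    and A_rank: "mat_rank A = n"
    and Es_precond: "Es \<in> nonsingular_blocks ms"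
  shows "\<forall>\<E> \<in> {nonsingular_blocks ms, admissible_blocks ms A}.
    is_arg_min (precond_omega A) (\<lambda>Fs. Fs \<in> \<E>) Es \<longleftrightarrow>
    (\<forall>j<length ms.
       As ! j * (As ! j)\<^sup>T =
       (1 / real n * mat_trace (mat_sum_list n
          (map (\<lambda>t. (As ! t)\<^sup>T * ((Es ! t)\<^sup>T * Es ! t) * As ! t) [0..<length ms]))) \<cdot>\<^sub>m
       (As ! j * mat_inv (A\<^sup>T * ((diag_block_mat Es)\<^sup>T * diag_block_mat Es) * A) * (As ! j)\<^sup>T))"
proof -
  have fit_iff: "Fs \<in> square_blocks ms \<longleftrightarrow> blocks_fit n Fs As" for Fs
  proof -
    have "As ! j \<in> carrier_mat (dim_row (As ! j)) n \<and> dim_row (As ! j) = ms ! j" if "j < length ms" for j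
      using As_dim that by auto
    then show ?thesis
      using len_As unfolding square_blocks_def blocks_fit_def list_all2_conv_all_nth mem_Collect_eq
      by (metis (no_types, lifting))
  qed
  have inv_iff: "Fs \<in> nonsingular_blocks ms \<longleftrightarrow> blocks_fit n Fs As \<and> (\<forall>F \<in> set Fs. det F \<noteq> 0)" for Fs
  proof -
    have "invertible_mat F \<longleftrightarrow> det F \<noteq> 0" if F: "Fs \<in> square_blocks ms" "F \<in> set Fs" for F
    proof -
      obtain k where "F \<in> carrier_mat k k"
        using F by (auto simp: square_blocks_def in_set_conv_nth)
      then show ?thesis by (rule invertible_mat_iff_det)
    qed
    then show ?thesis by (auto simp: nonsingular_blocks_def fit_iff)
  qed
  note E = Es_precond[unfolded inv_iff]
  define M where "M = precond_gram A Es"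
  note D = blocks_fit_stack[OF conjunct1[OF E], folded A_blocks]
  have M: "pos_def M" "M \<in> carrier_mat n n"
    using pos_def_precond_gram[of n Es As] E A_rank D(2)
    by (auto simp: M_def A_blocks precond_gram_def intro!: carrier_matI)
  \<comment> \<open>The sum under the trace is again the Gram matrix, so the scalar factor is
    \<open>mat_trace M / n\<close>.\<close>
  have sum: "mat_sum_list n (map (\<lambda>t. (As ! t)\<^sup>T * ((Es ! t)\<^sup>T * Es ! t) * As ! t) [0..<length ms]) = M"
  proof -
    have "length Es = length ms" using E len_As by (auto simp: blocks_fit_def dest: list_all2_lengthD)
    then have "map (\<lambda>t. (As ! t)\<^sup>T * ((Es ! t)\<^sup>T * Es ! t) * As ! t) [0..<length ms] = map2 block_gram Es As"
      using len_As by (intro nth_equalityI) (auto simp: block_gram_def)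
    then show ?thesis using D(3) by (simp add: M_def)
  qed
  have gram: "A\<^sup>T * ((diag_block_mat Es)\<^sup>T * diag_block_mat Es) * A = M"
  proof -
    define P m where "P = diag_block_mat Es" and "m = sum_list (map dim_row As)"
    have P: "P \<in> carrier_mat m m" "A \<in> carrier_mat m n" using D(1,2) by (auto simp: P_def m_def)
    then show ?thesis
      by (simp add: M_def precond_gram_def P_def[symmetric] transpose_mult[of _ m m _ n]
          assoc_mult_mat[of _ n m _ m _ n] assoc_mult_mat[of _ m m _ m _ n])
  qed
  have st_iff: "(\<forall>j<length ms. As ! j * (As ! j)\<^sup>T =
      (1 / real n * mat_trace M) \<cdot>\<^sub>m (As ! j * mat_inv M * (As ! j)\<^sup>T)) \<longleftrightarrow> omega_stationary n M As"
    by (auto simp: omega_stationary_def all_set_conv_all_nth len_As)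
  \<comment> \<open>Through this inclusion, minimality over admissible blocks restricts to
    nonsingular ones, where necessity is proved.\<close>
  have sub: "nonsingular_blocks ms \<subseteq> admissible_blocks ms A"
    using pos_def_precond_gram A_rank
    by (auto simp: admissible_blocks_def fit_iff inv_iff A_blocks)
  have opt: "precond_omega A Es \<le> precond_omega A Fs"
    if "omega_stationary n M As" "Fs \<in> admissible_blocks ms A" for Fs
    using omega_le_if_stationary[OF n_pos M that(1), of Fs] that(2)
    by (simp add: admissible_blocks_def fit_iff A_blocks M_def precond_omega_def)
  have st: "omega_stationary n M As"
    if "\<And>Fs. Fs \<in> nonsingular_blocks ms \<Longrightarrow> precond_omega A Es \<le> precond_omega A Fs"
    using omega_stationary_if_minimal[OF n_pos conjunct1[OF E], folded A_blocks] A_rank E that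
    by (simp add: inv_iff M_def)
  show ?thesis
    unfolding sum gram st_iff using Es_precond sub opt st
    by (auto simp: is_arg_min_linorder)
qed

end
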